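(* Consider a family of grids on $]0,R]$ with $\Delta x\to 0$. For each grid with $I$ cells let $\mathbf N(t)\in\mathbb R^I$ be the vector of exact cell integrals and let $\hat{\mathbf N}(t)\in\mathbb R^I$ be the solution of the cell average semi-discrete system $\frac{d\hat{\mathbf N}}{dt}=\hat{\mathbf B}(\hat{\mathbf N})-\hat{\mathbf D}(\hat{\mathbf N})$, $\hat{\mathbf N}(0)=\mathbf N(0)$. Assume that the Lipschitz conditions $$\|\hat{\mathbf B}(\mathbf N(t))-\hat{\mathbf B}(\hat{\mathbf N}(t))\|\le L\,\|\mathbf N(t)-\hat{\mathbf N}(t)\|,\qquad \|\hat{\mathbf D}(\mathbf N(t))-\hat{\mathbf D}(\hat{\mathbf N}(t))\|\le L\,\|\mathbf N(t)-\hat{\mathbf N}(t)\|$$ hold for all $0\le t\le T$, with a constant $L$ independent of $t$ and of the grid. If the scheme is consistent, then it is also convergent, and the convergence is of the same order as the consistency: if $\|\sigma(t)\|=\mathcal O(\Delta x^p)$ uniformly for $0\le t\le T$, then $\|\epsilon(t)\|=\mathcal O(\Delta x^p)$ uniformly for $0\le t\le T$, where $\sigma$ is the local discretization error and $\epsilon$ the global discretization error.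
   Context: Continuous problem. Fix $0<R<\infty$. The truncated Smoluchowski coagulation equation for $n(t,x)$, $x\in\,]0,R]$, $t\ge 0$, is $$\frac{\partial n(t,x)}{\partial t}=\frac12\int_0^x\beta(x-y,y)n(t,x-y)n(t,y)\,dy-\int_0^R\beta(x,y)n(t,x)n(t,y)\,dy,\qquad n(0,x)=n^{\rm in}(x)\ge 0.$$ The kernel satisfies $\beta\ge 0$, $\beta(x,y)=\beta(y,x)$, $\beta(x,y)=0$ if $x=0$ or $y=0$, and $\beta$ is twice continuously differentiable on $]0,R]\times]0,R]$. Grids. $]0,R]$ is divided into cells $\Lambda_i=\,]x_{i-1/2},x_{i+1/2}]$, $i=1,\dots,I$, with $x_{1/2}=0$, $x_{I+1/2}=R$, pivots $x_i=(x_{i-1/2}+x_{i+1/2})/2$ and widths $\Delta x_i=x_{i+1/2}-x_{i-1/2}$ satisfying $\Delta x_{\min}\le\Delta x_i\le\Delta x$, where $\Delta x/\Delta x_{\min}\le K$ for a constant $K>0$ that does not depend on the grid. Exact cell integrals. $\mathbf N(t)=(N_1(t),\dots,N_I(t))$ with $N_i(t)=\int_{x_{i-1/2}}^{x_{i+1/2}}n(t,x)\,dx$, where $n$ is the exact solution of the truncated equation. Cell average technique. For $\mathbf M=(M_1,\dots,M_I)\in\mathbb R^I$ put (with $\delta_{j,k}$ the Kronecker delta and sums over $1\le k\le j\le I$) $$\hat B_i(\mathbf M)=\sum_{\substack{j\ge k\\ x_{i-1/2}\le x_j+x_k<x_{i+1/2}}}\Bigl(1-\tfrac12\delta_{j,k}\Bigr)\beta(x_k,x_j)M_jM_k,$$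 $$\hat V_i(\mathbf M)=\sum_{\substack{j\ge k\\ x_{i-1/2}\le x_j+x_k<x_{i+1/2}}}\Bigl(1-\tfrac12\delta_{j,k}\Bigr)\beta(x_k,x_j)M_jM_k(x_j+x_k),$$ and $\overline v_i=\hat V_i(\mathbf M)/\hat B_i(\mathbf M)$ if $\hat B_i(\mathbf M)>0$, $\overline v_i=x_i$ if $\hat B_i(\mathbf M)=0$. Let $H(x)=1$ for $x>0$, $H(0)=\tfrac12$, $H(x)=0$ for $x<0$, and $\lambda_i^{\pm}(x)=\frac{x-x_{i\pm1}}{x_i-x_{i\pm1}}$. Auxiliary points $x_0<x_1$ and $x_{I+1}>x_I$ are fixed wherever these formulas refer to them. The $i$th component of $\hat{\mathbf B}(\mathbf M)$ is $$\hat B_i^{CA}=\hat B_{i-1}\lambda_i^-(\overline v_{i-1})H(\overline v_{i-1}-x_{i-1})+\hat B_i\lambda_i^+(\overline v_i)H(\overline v_i-x_i)+\hat B_i\lambda_i^-(\overline v_i)H(x_i-\overline v_i)+\hat B_{i+1}\lambda_i^+(\overline v_{i+1})H(x_{i+1}-\overline v_{i+1}),$$ where the first term is set to zero for $i=1$ and the fourth term is set to zero for $i=I$. The $i$th component of $\hat{\mathbf D}(\mathbf M)$ is $\hat D_i^{CA}=M_i\sum_{j=1}^I\beta(x_i,x_j)M_j$. Norm and errors. $\|\mathbf M\|=\sum_{i=1}^I|M_i|$. The local discretization error is $\sigma(t)=\frac{d\mathbf N(t)}{dt}-\bigl(\hat{\mathbf B}(\mathbf N(t))-\hat{\mathbf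 D}(\mathbf N(t))\bigr)$; the scheme is consistent of order $p$ if $\|\sigma(t)\|=\mathcal O(\Delta x^p)$ as $\Delta x\to0$, uniformly for $0\le t\le T$. The global discretization error is $\epsilon(t)=\mathbf N(t)-\hat{\mathbf N}(t)$; the scheme is convergent of order $p$ if $\|\epsilon(t)\|=\mathcal O(\Delta x^p)$ as $\Delta x\to0$, uniformly for $0\le t\le T$. *)

theory Defs
  imports "HOL-Analysis.Analysis" "HOL-Library.Landau_Symbols"
begin

section \<open>The truncated Smoluchowski equation\<close>

text \<open>Twice continuous Frechet differentiability relative to a set that need not be open. On
  the half-open square used below (convex, with nonempty interior) derivatives within the set are
  unique; on the sides \<open>x = R\<close> and \<open>y = R\<close> they are one-sided.\<close>

definition C2_on :: "'a::real_normed_vector set \<Rightarrow> ('a \<Rightarrow> 'b::real_normed_vector) \<Rightarrow> bool" where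
  "C2_on S f \<longleftrightarrow> (\<exists>(D1 :: 'a \<Rightarrow> 'a \<Rightarrow>\<^sub>L 'b) (D2 :: 'a \<Rightarrow> 'a \<Rightarrow>\<^sub>L 'a \<Rightarrow>\<^sub>L 'b).
     (\<forall>z\<in>S. (f has_derivative blinfun_apply (D1 z)) (at z within S)) \<and>
     (\<forall>z\<in>S. (D1 has_derivative blinfun_apply (D2 z)) (at z within S)) \<and>
     continuous_on S D2)"

definition coagulation_kernel :: "real \<Rightarrow> (real \<Rightarrow> real \<Rightarrow> real) \<Rightarrow> bool" where
  "coagulation_kernel R \<beta> \<longleftrightarrow>
     (\<forall>x\<in>{0..R}. \<forall>y\<in>{0..R}. 0 \<le> \<beta> x y \<and> \<beta> x y = \<beta> y x \<and> (x = 0 \<or> y = 0 \<longrightarrow> \<beta> x y = 0)) \<and>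
     C2_on ({0<..R} \<times> {0<..R}) (\<lambda>(x, y). \<beta> x y)"

text \<open>The equation holds pointwise in \<open>x\<close> and \<open>t\<close>, all integrals being Lebesgue integrals that
  are required to exist; at the ends of the time interval the time derivative is one-sided.\<close>

definition smoluchowski_solution ::
  "real \<Rightarrow> (real \<Rightarrow> real \<Rightarrow> real) \<Rightarrow> real \<Rightarrow> (real \<Rightarrow> real) \<Rightarrow> (real \<Rightarrow> real \<Rightarrow> real) \<Rightarrow> bool" where
  "smoluchowski_solution R \<beta> T n_in n \<longleftrightarrow>
     (\<forall>x\<in>{0<..R}. n 0 x = n_in x) \<and>
     (\<forall>t\<in>{0..T}. set_integrable lebesgue {0<..R} (n t)) \<and>
     (\<forall>t\<in>{0..T}. \<forall>x\<in>{0<..R}.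
        set_integrable lebesgue {0<..x} (\<lambda>y. \<beta> (x - y) y * n t (x - y) * n t y) \<and>
        set_integrable lebesgue {0<..R} (\<lambda>y. \<beta> x y * n t x * n t y) \<and>
        ((\<lambda>s. n s x) has_real_derivative
           (1 / 2 * (LINT y:{0<..x}|lebesgue. \<beta> (x - y) y * n t (x - y) * n t y)
            - (LINT y:{0<..R}|lebesgue. \<beta> x y * n t x * n t y))) (at t within {0..T}))"

section \<open>Grids\<close>

text \<open>\<open>edge g i\<close> stands for \<open>x\<^bsub>i+1/2\<^esub>\<close>, so that cell \<open>i\<close> (for \<open>i = 1, \<dots>, cells g\<close>) is
  \<open>{edge g (i - 1)<..edge g i}\<close>. The fields \<open>aux_left\<close> and \<open>aux_right\<close> are the auxiliary points
  \<open>x\<^sub>0\<close> and \<open>x\<^bsub>I+1\<^esub>\<close>; \<open>mesh\<close> and \<open>mesh_min\<close> are the bounds on the cell widths.\<close>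

record grid =
  cells :: nat
  edge :: "nat \<Rightarrow> real"
  aux_left :: real
  aux_right :: real
  mesh :: real
  mesh_min :: real

definition pivot :: "grid \<Rightarrow> nat \<Rightarrow> real" where
  "pivot g i = (if i = 0 then aux_left g
                else if i = cells g + 1 then aux_right g
                else (edge g (i - 1) + edge g i) / 2)"

definition valid_grid :: "real \<Rightarrow> real \<Rightarrow> grid \<Rightarrow> bool" where
  "valid_grid R K g \<longleftrightarrow>
     1 \<le> cells g \<and> edge g 0 = 0 \<and> edge g (cells g) = R \<and>
     0 < mesh_min g \<and>
     (\<forall>i\<in>{1..cells g}. mesh_min g \<le> edge g i - edge g (i - 1) \<and> edge g i - edge g (i - 1) \<le> mesh g) \<and>
     mesh g / mesh_min g \<le> K \<and>
     pivot g 0 < pivot g 1 \<and> pivot g (cells g) < pivot g (cells g + 1)"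

text \<open>A vector in \<open>\<real>\<^sup>I\<close> is a function on \<open>nat\<close> of which only the values at
  \<open>1, \<dots>, I = cells g\<close> matter.\<close>

definition grid_norm :: "grid \<Rightarrow> (nat \<Rightarrow> real) \<Rightarrow> real" where
  "grid_norm g M = (\<Sum>i = 1..cells g. \<bar>M i\<bar>)"

definition cell_integral :: "grid \<Rightarrow> (real \<Rightarrow> real) \<Rightarrow> nat \<Rightarrow> real" where
  "cell_integral g u i = (LINT x:{edge g (i - 1)<..edge g i}|lebesgue. u x)"

section \<open>The cell average technique\<close>

definition birth_pairs :: "grid \<Rightarrow> nat \<Rightarrow> (nat \<times> nat) set" where
  "birth_pairs g i = {(j, k). 1 \<le> k \<and> k \<le> j \<and> j \<le> cells g \<and>
      edge g (i - 1) \<le> pivot g j + pivot g k \<and> pivot g j + pivot g k < edge g i}"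

definition birth :: "(real \<Rightarrow> real \<Rightarrow> real) \<Rightarrow> grid \<Rightarrow> (nat \<Rightarrow> real) \<Rightarrow> nat \<Rightarrow> real" where
  "birth \<beta> g M i = (\<Sum>(j, k)\<in>birth_pairs g i.
      (1 - 1 / 2 * (if j = k then 1 else 0)) * \<beta> (pivot g k) (pivot g j) * M j * M k)"

definition birth_volume :: "(real \<Rightarrow> real \<Rightarrow> real) \<Rightarrow> grid \<Rightarrow> (nat \<Rightarrow> real) \<Rightarrow> nat \<Rightarrow> real" where
  "birth_volume \<beta> g M i = (\<Sum>(j, k)\<in>birth_pairs g i.
      (1 - 1 / 2 * (if j = k then 1 else 0)) * \<beta> (pivot g k) (pivot g j) * M j * M k
        * (pivot g j + pivot g k))"

text \<open>For vectors with negative entries \<open>birth\<close> can be negative, a case in which the average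
  is not specified by the scheme; here it is then the pivot.\<close>

definition avg_volume :: "(real \<Rightarrow> real \<Rightarrow> real) \<Rightarrow> grid \<Rightarrow> (nat \<Rightarrow> real) \<Rightarrow> nat \<Rightarrow> real" where
  "avg_volume \<beta> g M i =
     (if birth \<beta> g M i > 0 then birth_volume \<beta> g M i / birth \<beta> g M i else pivot g i)"

definition heaviside :: "real \<Rightarrow> real" where
  "heaviside x = (if x > 0 then 1 else if x = 0 then 1 / 2 else 0)"

definition lambda_minus :: "grid \<Rightarrow> nat \<Rightarrow> real \<Rightarrow> real" where
  "lambda_minus g i x = (x - pivot g (i - 1)) / (pivot g i - pivot g (i - 1))"

definition lambda_plus :: "grid \<Rightarrow> nat \<Rightarrow> real \<Rightarrow> real" where
  "lambda_plus g i x = (x - pivot g (i + 1)) / (pivot g i - pivot g (i + 1))"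

definition birth_CA :: "(real \<Rightarrow> real \<Rightarrow> real) \<Rightarrow> grid \<Rightarrow> (nat \<Rightarrow> real) \<Rightarrow> nat \<Rightarrow> real" where
  "birth_CA \<beta> g M i =
     (let B = birth \<beta> g M; v = avg_volume \<beta> g M; x = pivot g in
        (if i = 1 then 0
         else B (i - 1) * lambda_minus g i (v (i - 1)) * heaviside (v (i - 1) - x (i - 1)))
      + B i * lambda_plus g i (v i) * heaviside (v i - x i)
      + B i * lambda_minus g i (v i) * heaviside (x i - v i)
      + (if i = cells g then 0
         else B (i + 1) * lambda_plus g i (v (i + 1)) * heaviside (x (i + 1) - v (i + 1))))"

definition death_CA :: "(real \<Rightarrow> real \<Rightarrow> real) \<Rightarrow> grid \<Rightarrow> (nat \<Rightarrow> real) \<Rightarrow> nat \<Rightarrow> real" where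
  "death_CA \<beta> g M i = M i * (\<Sum>j = 1..cells g. \<beta> (pivot g i) (pivot g j) * M j)"

definition cell_average_solution ::
  "(real \<Rightarrow> real \<Rightarrow> real) \<Rightarrow> real \<Rightarrow> grid \<Rightarrow> (nat \<Rightarrow> real) \<Rightarrow> (real \<Rightarrow> nat \<Rightarrow> real) \<Rightarrow> bool" where
  "cell_average_solution \<beta> T g N0 Nh \<longleftrightarrow>
     (\<forall>i\<in>{1..cells g}. Nh 0 i = N0 i) \<and>
     (\<forall>t\<in>{0..T}. \<forall>i\<in>{1..cells g}.
        ((\<lambda>s. Nh s i) has_real_derivative (birth_CA \<beta> g (Nh t) i - death_CA \<beta> g (Nh t) i))
          (at t within {0..T}))"

section \<open>Discretization errors, consistency and convergence\<close>

definition local_error ::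
  "(real \<Rightarrow> real \<Rightarrow> real) \<Rightarrow> real \<Rightarrow> grid \<Rightarrow> (real \<Rightarrow> real \<Rightarrow> real) \<Rightarrow> real \<Rightarrow> nat \<Rightarrow> real" where
  "local_error \<beta> T g n t i =
     vector_derivative (\<lambda>s. cell_integral g (n s) i) (at t within {0..T})
     - (birth_CA \<beta> g (cell_integral g (n t)) i - death_CA \<beta> g (cell_integral g (n t)) i)"

definition global_error ::
  "grid \<Rightarrow> (real \<Rightarrow> real \<Rightarrow> real) \<Rightarrow> (real \<Rightarrow> nat \<Rightarrow> real) \<Rightarrow> real \<Rightarrow> nat \<Rightarrow> real" where
  "global_error g n Nh t i = cell_integral g (n t) i - Nh t i"

text \<open>A family of grids is a function \<open>G\<close> on an arbitrary index type, and \<open>F\<close> is a filter on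
  the indices along which the mesh tends to 0. The product with \<open>principal {0..T}\<close> expresses
  uniformity in time: the constant and the set of admissible indices do not depend on \<open>t\<close>.\<close>

definition consistent_of_order ::
  "(real \<Rightarrow> real \<Rightarrow> real) \<Rightarrow> real \<Rightarrow> 'k filter \<Rightarrow> ('k \<Rightarrow> grid) \<Rightarrow> (real \<Rightarrow> real \<Rightarrow> real) \<Rightarrow> real \<Rightarrow> bool" where
  "consistent_of_order \<beta> T F G n p \<longleftrightarrow>
     (\<lambda>(k, t). grid_norm (G k) (local_error \<beta> T (G k) n t))
       \<in> O[F \<times>\<^sub>F principal {0..T}](\<lambda>(k, t). mesh (G k) powr p)"

definition convergent_of_order ::
  "real \<Rightarrow> 'k filter \<Rightarrow> ('k \<Rightarrow> grid) \<Rightarrow> (real \<Rightarrow> real \<Rightarrow> real) \<Rightarrow> ('k \<Rightarrow> real \<Rightarrow> nat \<Rightarrow> real) \<Rightarrow> real \<Rightarrow> bool" where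
  "convergent_of_order T F G n Nh p \<longleftrightarrow>
     (\<lambda>(k, t). grid_norm (G k) (global_error (G k) n (Nh k) t))
       \<in> O[F \<times>\<^sub>F principal {0..T}](\<lambda>(k, t). mesh (G k) powr p)"

end

theory Submission
  imports Defs
begin

text \<open>The global error \<open>\<epsilon>\<close> vanishes at time 0 and \<open>\<epsilon>' = \<sigma> + (B(N) - B(Nh)) - (D(N) - D(Nh))\<close>,
  so that \<open>\<parallel>\<epsilon>'\<parallel> \<le> \<parallel>\<sigma>\<parallel> + 2 L \<parallel>\<epsilon>\<parallel>\<close>. Gronwall's argument then bounds \<open>\<parallel>\<epsilon>\<parallel>\<close> by
  \<open>sup \<parallel>\<sigma>\<parallel>\<close> times a constant that depends only on \<open>L\<close> and \<open>T\<close>.\<close>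

text \<open>The idea is to take the maximum \<open>M\<close> of \<open>exp (-2 A t) \<parallel>e t\<parallel>\<close>, attained at \<open>\<tau>\<close>, and to
  freeze the signs of the components of \<open>e \<tau>\<close>: this avoids differentiating the norm and
  integrating the possibly nonintegrable derivative.\<close>

lemma gronwall_sum_abs:
  fixes e e' :: "real \<Rightarrow> 'i \<Rightarrow> real" and A s T :: real
  assumes "0 \<le> A" and "0 \<le> s"
    and deriv: "\<And>i t. i \<in> I \<Longrightarrow> t \<in> {0..T} \<Longrightarrow>
      ((\<lambda>r. e r i) has_real_derivative e' t i) (at t within {0..T})"
    and init: "\<And>i. i \<in> I \<Longrightarrow> e 0 i = 0"
    and bound: "\<And>t. t \<in> {0..T} \<Longrightarrow> (\<Sum>i\<in>I. \<bar>e' t i\<bar>) \<le> s + A * (\<Sum>i\<in>I. \<bar>e t i\<bar>)"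
    and t: "t \<in> {0..T}"
  shows "(\<Sum>i\<in>I. \<bar>e t i\<bar>) \<le> 2 * s * T * exp (2 * A * T)"
proof -
  define u where "u r = (\<Sum>i\<in>I. \<bar>e r i\<bar>)" for r
  have cont_e: "continuous_on {0..T} (\<lambda>r. e r i)" if "i \<in> I" for i
    using deriv[OF that] by (meson DERIV_continuous_on)
  have "continuous_on {0..T} (\<lambda>r. exp (- (2 * A * r)) * u r)"
    unfolding u_def by (intro continuous_intros cont_e)
  then obtain \<tau> where \<tau>: "\<tau> \<in> {0..T}"
    and max: "\<And>r. r \<in> {0..T} \<Longrightarrow> exp (- (2 * A * r)) * u r \<le> exp (- (2 * A * \<tau>)) * u \<tau>"
    using continuous_attains_sup[of "{0..T}"] t by force
  \<comment> \<open>\<open>M\<close> is the least constant for which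
    \<open>M * exp (2 * A * r)\<close> dominates \<open>u r\<close> on the whole interval; the two
    agree at \<open>\<tau>\<close>.\<close>
  define M where "M = exp (- (2 * A * \<tau>)) * u \<tau>"
  have u_le: "u r \<le> M * exp (2 * A * r)" if "r \<in> {0..T}" for r
    using max[OF that] by (simp add: M_def exp_minus field_simps)
  have u_\<tau>: "u \<tau> = M * exp (2 * A * \<tau>)"
    by (simp add: M_def exp_minus field_simps)
  have "0 \<le> M"
    by (simp add: M_def u_def sum_nonneg)
  \<comment> \<open>Linear in \<open>e\<close>, hence differentiable even where \<open>u\<close> is
    not; it meets \<open>u\<close> at \<open>\<tau>\<close>, and its derivative is at most the norm
    of \<open>e'\<close>.\<close>
  define w where "w r = (\<Sum>i\<in>I. sgn (e \<tau> i) * e r i)" for r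
  \<comment> \<open>The first two terms form an antiderivative of
    \<open>s + A * (M * exp (2 * A * r))\<close>, which bounds the derivative of \<open>w\<close>.
    The rate \<open>2 * A\<close> instead of \<open>A\<close> produces the factor 1/2, so that at
    \<open>\<tau>\<close> the exponential term is only \<open>u \<tau> / 2\<close> and can be
    absorbed.\<close>
  define \<phi> where "\<phi> r = s * r + M / 2 * exp (2 * A * r) - w r" for r
  have "\<phi> 0 \<le> \<phi> \<tau>"
  proof (rule DERIV_nonneg_imp_increasing_open[of 0 \<tau>])
    show "0 \<le> \<tau>" using \<tau> by simp
    have "continuous_on {0..T} \<phi>"
      unfolding \<phi>_def w_def by (intro continuous_intros cont_e)
    then show "continuous_on {0..\<tau>} \<phi>"
      using \<tau> by (auto intro: continuous_on_subset)
    fix r assume r: "0 < r" "r < \<tau>"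
    \<comment> \<open>Interior points suffice for monotonicity, and there the derivative within the
      interval is two-sided.\<close>
    have rT: "r \<in> {0..T}" and at: "at r within {0..T} = at r"
      using r \<tau> by (auto intro: at_within_Icc_at)
    have "(\<phi> has_real_derivative
        s + A * (M * exp (2 * A * r)) - (\<Sum>i\<in>I. sgn (e \<tau> i) * e' r i)) (at r)"
      unfolding \<phi>_def w_def
      by (rule derivative_eq_intros DERIV_sum DERIV_cmult deriv[OF _ rT, unfolded at] refl | assumption | simp)+
    moreover have "(\<Sum>i\<in>I. sgn (e \<tau> i) * e' r i) \<le> (\<Sum>i\<in>I. \<bar>e' r i\<bar>)"
      by (rule sum_mono) (auto simp: sgn_if)
    moreover have "A * u r \<le> A * (M * exp (2 * A * r))"
      using u_le[OF rT] \<open>0 \<le> A\<close> by (rule mult_left_mono)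
    ultimately show "\<exists>y. (\<phi> has_real_derivative y) (at r) \<and> 0 \<le> y"
      using bound[OF rT] unfolding u_def by (intro exI conjI) (assumption, linarith)
  qed
  moreover have "w 0 = 0" "w \<tau> = u \<tau>"
    by (simp_all add: w_def u_def init mult.commute abs_sgn)
  ultimately have "u \<tau> \<le> s * \<tau> + u \<tau> / 2 - M / 2"
    by (simp add: \<phi>_def u_\<tau>)
  moreover have "s * \<tau> \<le> s * T"
    using \<tau> \<open>0 \<le> s\<close> by (simp add: mult_left_mono)
  ultimately have "u \<tau> \<le> 2 * s * T"
    using \<open>0 \<le> M\<close> by simp
  moreover have "M \<le> u \<tau>"
    using \<open>0 \<le> M\<close> \<open>0 \<le> A\<close> \<tau> by (simp add: u_\<tau> mult_le_cancel_left1)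
  ultimately have "M \<le> 2 * s * T"
    by simp
  have "u t \<le> M * exp (2 * A * t)"
    by (rule u_le[OF t])
  also have "\<dots> \<le> 2 * s * T * exp (2 * A * T)"
    using \<open>M \<le> 2 * s * T\<close> \<open>0 \<le> M\<close> \<open>0 \<le> A\<close> \<open>0 \<le> s\<close> t by (intro mult_mono) (auto simp: mult_left_mono)
  finally show ?thesis
    by (simp add: u_def)
qed

text \<open>A set belongs to the principal filter iff it contains \<open>S\<close>, so
  \<open>S\<close> itself serves as the second factor. This turns Landau bounds on the product
  filter into bounds uniform in time.\<close>

lemma eventually_prod_principal:
  "eventually P (F \<times>\<^sub>F principal S) \<longleftrightarrow> (\<forall>\<^sub>F x in F. \<forall>y\<in>S. P (x, y))"
  unfolding eventually_prod_filter eventually_principal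
  by (fastforce elim: eventually_mono
      intro: exI[of _ "\<lambda>x. \<forall>y\<in>S. P (x, y)"] exI[of _ "\<lambda>y. y \<in> S"])

lemma grid_norm_nonneg: "0 \<le> grid_norm g M"
  by (simp add: grid_norm_def sum_nonneg)

text \<open>Gronwall on a single grid, with \<open>A = 2 * \<bar>L\<bar>\<close>: one Lipschitz
  constant for birth, one for death.\<close>

lemma global_error_bound:
  fixes \<beta> :: "real \<Rightarrow> real \<Rightarrow> real" and L T s :: real
  assumes diff: "\<And>i t. i \<in> {1..cells g} \<Longrightarrow> t \<in> {0..T} \<Longrightarrow>
      (\<lambda>r. cell_integral g (n r) i) differentiable (at t within {0..T})"
    and sol: "cell_average_solution \<beta> T g (cell_integral g (n 0)) Nh"
    and lip_birth: "\<And>t. t \<in> {0..T} \<Longrightarrow>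
      grid_norm g (\<lambda>i. birth_CA \<beta> g (cell_integral g (n t)) i - birth_CA \<beta> g (Nh t) i)
        \<le> L * grid_norm g (global_error g n Nh t)"
    and lip_death: "\<And>t. t \<in> {0..T} \<Longrightarrow>
      grid_norm g (\<lambda>i. death_CA \<beta> g (cell_integral g (n t)) i - death_CA \<beta> g (Nh t) i)
        \<le> L * grid_norm g (global_error g n Nh t)"
    and local: "\<And>t. t \<in> {0..T} \<Longrightarrow> grid_norm g (local_error \<beta> T g n t) \<le> s"
    and t: "t \<in> {0..T}"
  shows "grid_norm g (global_error g n Nh t) \<le> 2 * s * T * exp (4 * \<bar>L\<bar> * T)"
proof -
  define b where "b r i = birth_CA \<beta> g (cell_integral g (n r)) i - birth_CA \<beta> g (Nh r) i" for r i
  define d where "d r i = death_CA \<beta> g (cell_integral g (n r)) i - death_CA \<beta> g (Nh r) i" for r i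
  define e' where "e' r i = local_error \<beta> T g n r i + b r i - d r i" for r i
  have deriv: "((\<lambda>r. global_error g n Nh r i) has_real_derivative e' r i) (at r within {0..T})"
    if "i \<in> {1..cells g}" "r \<in> {0..T}" for i r
  proof -
    \<comment> \<open>\<open>vector_derivative\<close> is a choice operator; differentiability makes
      the value in \<open>local_error\<close> the actual derivative.\<close>
    have "((\<lambda>r. cell_integral g (n r) i) has_real_derivative
        vector_derivative (\<lambda>r. cell_integral g (n r) i) (at r within {0..T})) (at r within {0..T})"
      using diff[OF that]
      by (simp add: vector_derivative_works has_real_derivative_iff_has_vector_derivative)
    moreover have "((\<lambda>r. Nh r i) has_real_derivative
        (birth_CA \<beta> g (Nh r) i - death_CA \<beta> g (Nh r) i)) (at r within {0..T})"
      using sol that by (simp add: cell_average_solution_def)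
    ultimately show ?thesis
      unfolding global_error_def e'_def b_def d_def local_error_def
      by (rule DERIV_diff[THEN DERIV_cong]) simp
  qed
  have bound: "grid_norm g (e' r) \<le> s + 2 * \<bar>L\<bar> * grid_norm g (global_error g n Nh r)"
    if r: "r \<in> {0..T}" for r
  proof -
    have "grid_norm g (e' r) \<le> grid_norm g (local_error \<beta> T g n r) + grid_norm g (b r) + grid_norm g (d r)"
      unfolding grid_norm_def e'_def sum.distrib[symmetric] by (rule sum_mono) linarith
    \<comment> \<open>No sign of \<open>L\<close> is assumed, while Gronwall asks for a nonnegative
      coefficient.\<close>
    moreover have "L * grid_norm g (global_error g n Nh r) \<le> \<bar>L\<bar> * grid_norm g (global_error g n Nh r)"
      by (intro mult_right_mono grid_norm_nonneg) simp
    ultimately show ?thesis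
      using local[OF r] lip_birth[OF r] lip_death[OF r] unfolding b_def d_def by linarith
  qed
  have "0 \<le> s"
    using local[OF t] grid_norm_nonneg order_trans by blast
  have init: "global_error g n Nh 0 i = 0" if "i \<in> {1..cells g}" for i
    using sol that by (simp add: cell_average_solution_def global_error_def)
  have "(\<Sum>i = 1..cells g. \<bar>global_error g n Nh t i\<bar>) \<le> 2 * s * T * exp (2 * (2 * \<bar>L\<bar>) * T)"
    by (rule gronwall_sum_abs[where e' = e', OF _ \<open>0 \<le> s\<close> deriv init bound[unfolded grid_norm_def] t]) auto
  then show ?thesis
    by (simp add: grid_norm_def)
qed

theorem theorem2p4:
  fixes R T K L :: real
    and \<beta> :: "real \<Rightarrow> real \<Rightarrow> real"
    and n_in :: "real \<Rightarrow> real"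
    and n :: "real \<Rightarrow> real \<Rightarrow> real"
    and F :: "'k filter"
    and G :: "'k \<Rightarrow> grid"
    and Nh :: "'k \<Rightarrow> real \<Rightarrow> nat \<Rightarrow> real"
  assumes "0 < R" and "0 < T" and "0 < K"
    and "coagulation_kernel R \<beta>"
    and "\<forall>x\<in>{0<..R}. 0 \<le> n_in x"
    and "smoluchowski_solution R \<beta> T n_in n"
    and "\<forall>k. valid_grid R K (G k)"
    and "((\<lambda>k. mesh (G k)) \<longlongrightarrow> 0) F"
    and "\<forall>k. \<forall>i\<in>{1..cells (G k)}. \<forall>t\<in>{0..T}.
           (\<lambda>s. cell_integral (G k) (n s) i) differentiable (at t within {0..T})"
    and "\<forall>k. cell_average_solution \<beta> T (G k) (cell_integral (G k) (n 0)) (Nh k)"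
    and "\<forall>k. \<forall>t\<in>{0..T}.
           grid_norm (G k) (\<lambda>i. birth_CA \<beta> (G k) (cell_integral (G k) (n t)) i
                                 - birth_CA \<beta> (G k) (Nh k t) i)
             \<le> L * grid_norm (G k) (\<lambda>i. cell_integral (G k) (n t) i - Nh k t i)"
    and "\<forall>k. \<forall>t\<in>{0..T}.
           grid_norm (G k) (\<lambda>i. death_CA \<beta> (G k) (cell_integral (G k) (n t)) i
                                 - death_CA \<beta> (G k) (Nh k t) i)
             \<le> L * grid_norm (G k) (\<lambda>i. cell_integral (G k) (n t) i - Nh k t i)"
  shows "\<forall>p. consistent_of_order \<beta> T F G n p \<longrightarrow> convergent_of_order T F G n Nh p"
proof (intro allI impI)
  fix p
  assume "consistent_of_order \<beta> T F G n p"
  then obtain c where "0 < c" and "\<forall>\<^sub>F (k, t) in F \<times>\<^sub>F principal {0..T}.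
      norm (grid_norm (G k) (local_error \<beta> T (G k) n t)) \<le> c * norm (mesh (G k) powr p)"
    unfolding consistent_of_order_def by (auto elim!: landau_o.bigE simp: case_prod_unfold)
  then have local: "\<forall>\<^sub>F k in F. \<forall>t\<in>{0..T}.
      grid_norm (G k) (local_error \<beta> T (G k) n t) \<le> c * mesh (G k) powr p"
    by (simp add: eventually_prod_principal grid_norm_nonneg)
  have "\<forall>\<^sub>F k in F. \<forall>t\<in>{0..T}. grid_norm (G k) (global_error (G k) n (Nh k) t)
      \<le> (2 * c * T * exp (4 * \<bar>L\<bar> * T)) * mesh (G k) powr p"
    using local
  proof eventually_elim
    case (elim k)
    show ?case
    proof
      fix t assume "t \<in> {0..T}"
      \<comment> \<open>Each grid has its own \<open>s = c * mesh (G k) powr p\<close>; the other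
        factors depend only on \<open>L\<close> and \<open>T\<close>, so the order \<open>p\<close>
        is kept.\<close>
      then have "grid_norm (G k) (global_error (G k) n (Nh k) t)
          \<le> 2 * (c * mesh (G k) powr p) * T * exp (4 * \<bar>L\<bar> * T)"
        using assms(9-12) elim
        by (intro global_error_bound[where \<beta> = \<beta>]) (auto simp: global_error_def[abs_def])
      then show "grid_norm (G k) (global_error (G k) n (Nh k) t)
          \<le> (2 * c * T * exp (4 * \<bar>L\<bar> * T)) * mesh (G k) powr p"
        by (simp add: mult_ac)
    qed
  qed
  then show "convergent_of_order T F G n Nh p"
    unfolding convergent_of_order_def
    \<comment> \<open>Positivity of \<open>c\<close> and \<open>T\<close> makes the Landau constant
      positive.\<close>
    using \<open>0 < c\<close> \<open>0 < T\<close>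
    by (intro landau_o.bigI[of "2 * c * T * exp (4 * \<bar>L\<bar> * T)"])
       (auto simp: eventually_prod_principal grid_norm_nonneg case_prod_unfold)
qed

end
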